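(* Let $R=\{(0,0),(0,1),(0,2),(3,0),(1,2),(1,3),(2,2),(2,3)\}$ and $R'=\{(0,0),(1,0),(2,0),(0,3),(2,1),(2,2),(3,1),(3,2)\}$. Then $(123,R)\sim_{jd}(132,R)$ and $(123,R')\sim_{jd}(132,R')$.
   Context: $S_n$ is the set of permutations $\pi=\pi_1\cdots\pi_n$ of $\{1,\dots,n\}$. A mesh pattern of length $k$ is a pair $(\tau,R)$ with $\tau\in S_k$ and $R\subseteq\{0,\dots,k\}\times\{0,\dots,k\}$ (the set of shaded boxes; box $(a,b)$ is the unit square with lower-left corner $(a,b)$). An occurrence of $(\tau,R)$ in $\pi\in S_n$ is a subsequence $\pi_{i_1}\cdots\pi_{i_k}$, $i_1<\dots<i_k$, order-isomorphic to $\tau$, such that, with $i_0=0$, $i_{k+1}=n+1$, with $v_1<\dots<v_k$ the values $\pi_{i_1},\dots,\pi_{i_k}$ in increasing order, and $v_0=0$, $v_{k+1}=n+1$, for each $(a,b)\in R$ there is no index $m$ with $i_a<m<i_{a+1}$ and $v_b<\pi_m<v_{b+1}$. Two mesh patterns $q_1,q_2$ are jointly equidistributed, written $q_1\sim_{jd}q_2$, if for all nonnegative integers $n,k,\ell$ the number of $\pi\in S_n$ with exactly $k$ occurrences of $q_1$ and $\ell$ occurrences of $q_2$ equals the number of $\pi\in S_n$ with exactly $\ell$ occurrences of $q_1$ and $k$ occurrences of $q_2$. *)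

theory Defs
  imports "HOL-Combinatorics.Multiset_Permutations"
begin

text \<open>
  Permutations of \<open>{1..n}\<close> are words in one-line notation, i.e. lists. Positions and values
  are counted from 1, so the entry at position \<open>m\<close> is \<open>\<pi> ! (m - 1)\<close>.
\<close>

definition perms :: "nat \<Rightarrow> nat list set" where
  "perms n = permutations_of_set {1..n}"

definition entry :: "nat list \<Rightarrow> nat \<Rightarrow> nat" where
  "entry \<pi> m = \<pi> ! (m - 1)"

text \<open>
  In a mesh pattern \<open>(\<tau>, R)\<close> of length \<open>k = length \<tau>\<close> the word \<open>\<tau>\<close> is meant to lie in
  \<open>perms k\<close> and \<open>R\<close> in \<open>{0..k} \<times> {0..k}\<close>; the type does not enforce this.
\<close>

type_synonym mesh_pattern = "nat list \<times> (nat \<times> nat) set"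

definition order_isomorphic :: "nat list \<Rightarrow> nat list \<Rightarrow> bool" where
  "order_isomorphic xs ys \<longleftrightarrow> length xs = length ys \<and>
     (\<forall>s < length xs. \<forall>t < length xs. xs ! s < xs ! t \<longleftrightarrow> ys ! s < ys ! t)"

text \<open>
  An occurrence is represented by its list \<open>is = [i\<^sub>1, \<dots>, i\<^sub>k]\<close> of positions. The lists
  \<open>ps\<close> and \<open>vs\<close> below are \<open>i\<^sub>0, \<dots>, i\<^sub>k\<^sub>+\<^sub>1\<close> and \<open>v\<^sub>0, \<dots>, v\<^sub>k\<^sub>+\<^sub>1\<close>.
\<close>

definition occurrence :: "mesh_pattern \<Rightarrow> nat list \<Rightarrow> nat list \<Rightarrow> bool" where
  "occurrence = (\<lambda>(\<tau>, R) \<pi> is.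
     let n = length \<pi>;
         ws = map (entry \<pi>) is;
         ps = [0] @ is @ [n + 1];
         vs = [0] @ sort ws @ [n + 1]
     in sorted_wrt (<) is \<and> set is \<subseteq> {1..n} \<and> order_isomorphic ws \<tau> \<and>
        (\<forall>(a, b) \<in> R. \<not> (\<exists>m \<in> {1..n}.
           ps ! a < m \<and> m < ps ! (a + 1) \<and> vs ! b < entry \<pi> m \<and> entry \<pi> m < vs ! (b + 1))))"

definition occurrences :: "mesh_pattern \<Rightarrow> nat list \<Rightarrow> nat" where
  "occurrences q \<pi> = card {is. occurrence q \<pi> is}"

definition jointly_equidistributed :: "mesh_pattern \<Rightarrow> mesh_pattern \<Rightarrow> bool"
    (infix \<open>\<sim>\<^sub>j\<^sub>d\<close> 50) where
  "q1 \<sim>\<^sub>j\<^sub>d q2 \<longleftrightarrow> (\<forall>n k l.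
     card {\<pi> \<in> perms n. occurrences q1 \<pi> = k \<and> occurrences q2 \<pi> = l} =
     card {\<pi> \<in> perms n. occurrences q1 \<pi> = l \<and> occurrences q2 \<pi> = k})"

text \<open>Every \<open>card\<close> above is taken of a finite set.\<close>

lemma finite_perms: "finite (perms n)"
  by (simp add: perms_def)

lemma finite_occurrences: "finite {is. occurrence q \<pi> is}"
proof (rule finite_subset)
  show "{is. occurrence q \<pi> is} \<subseteq>
      {is. set is \<subseteq> {1..length \<pi>} \<and> length is = length (fst q)}"
    by (auto simp: occurrence_def order_isomorphic_def Let_def split: prod.splits)
  show "finite {is. set is \<subseteq> {1..length \<pi>} \<and> length is = length (fst q)}"
    by (rule finite_lists_length_eq) simp
qed

end

theory Submission
  imports Defs
begin

text \<open>
  The shading \<open>R\<close> forces the entries at the last two positions \<open>j, k\<close> of an occurrence at \<open>i, j, k\<close>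
  to be the two largest ones at the positions in \<open>(i, k]\<close>, and the remaining conditions make \<open>i\<close> and
  \<open>j\<close> unique once \<open>k\<close> is given. So each position \<open>k\<close> ends at most one occurrence, of 123 or of 132,
  and exchanging the entries at \<open>j\<close> and \<open>k\<close> toggles between the two without changing which pattern
  ends at any other position. Toggling at every \<open>k\<close> in turn is a bijection that exchanges the two
  statistics. Since \<open>R'\<close> is the transpose of \<open>R\<close> and both 123 and 132 are involutions, passing to
  inverse permutations reduces the second claim to the first.
\<close>

section \<open>Permutations as functions\<close>

text \<open>On functions, swapping the entries at two positions is composition with a transposition,
  and the inverse permutation is \<open>inv\<close>. Words are needed only to count
  occurrences.\<close>

definition word :: "nat \<Rightarrow> (nat \<Rightarrow> nat) \<Rightarrow> nat list" where
  "word n p = map p [1..<Suc n]"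

lemma length_word [simp]: "length (word n p) = n"
  by (simp add: word_def)

lemma entry_word: "1 \<le> m \<Longrightarrow> m \<le> n \<Longrightarrow> entry (word n p) m = p m"
  unfolding entry_def word_def by (subst nth_map) (auto simp del: upt_Suc)

lemma bij_betw_word: "bij_betw (word n) {p. p permutes {1..n}} (perms n)"
proof -
  have inj: "inj_on (word n) {p. p permutes {1..n}}"
  proof (rule inj_onI, rule ext)
    fix p q m
    assume pq: "p \<in> {p. p permutes {1..n}}" "q \<in> {p. p permutes {1..n}}" "word n p = word n q"
    show "p m = q m"
    proof (cases "m \<in> {1..n}")
      case True
      then show ?thesis using pq(3) entry_word[of m n p] entry_word[of m n q] by simp
    next
      case False
      then show ?thesis using pq by (metis mem_Collect_eq permutes_not_in)
    qed
  qed
  have sub: "word n ` {p. p permutes {1..n}} \<subseteq> perms n"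
  proof clarify
    fix p assume p: "p permutes {1..n}"
    have "set [1..<Suc n] = {1..n}" by auto
    then have "set (word n p) = {1..n}"
      using permutes_image[OF p] unfolding word_def by (simp del: upt_Suc)
    moreover have "distinct (word n p)"
      unfolding word_def distinct_map
      using permutes_inj[OF p] by (auto intro: inj_on_subset simp del: upt_Suc)
    ultimately show "word n p \<in> perms n"
      by (simp add: perms_def permutations_of_set_def)
  qed
  \<comment> \<open>Surjectivity comes from counting: both sets have n! elements.\<close>
  have "card (word n ` {p. p permutes {1..n}}) = card (perms n)"
    using card_image[OF inj] card_permutations[of "{1..n}" n]
    by (simp add: perms_def)
  then have "word n ` {p. p permutes {1..n}} = perms n"
    using card_subset_eq[OF finite_perms sub] by blast
  with inj show ?thesis by (simp add: bij_betw_def)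
qed

section \<open>Occurrences sharing a last position\<close>

text \<open>
  This is the condition that the shading \<open>R\<close> imposes on the positions \<open>i, j, k\<close>. It is symmetric
  in \<open>p j\<close> and \<open>p k\<close>, whose relative order decides between the patterns 123 and 132.
\<close>

definition top_pair :: "nat \<Rightarrow> (nat \<Rightarrow> nat) \<Rightarrow> nat \<Rightarrow> nat \<Rightarrow> nat \<Rightarrow> bool" where
  "top_pair n p i j k \<longleftrightarrow> 1 \<le> i \<and> i < j \<and> j < k \<and> k \<le> n \<and> p i < p j \<and> p i < p k \<and>
     (\<forall>m. 1 \<le> m \<and> m < i \<longrightarrow> p j < p m \<and> p k < p m) \<and>
     (\<forall>m. i < m \<and> m < k \<and> m \<noteq> j \<longrightarrow> p m < p j \<and> p m < p k) \<and>
     (\<forall>m. k < m \<and> m \<le> n \<longrightarrow> p i < p m)"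

definition asc_ends :: "nat \<Rightarrow> (nat \<Rightarrow> nat) \<Rightarrow> nat set" where
  "asc_ends n p = {k. \<exists>i j. top_pair n p i j k \<and> p j < p k}"

definition desc_ends :: "nat \<Rightarrow> (nat \<Rightarrow> nat) \<Rightarrow> nat set" where
  "desc_ends n p = {k. \<exists>i j. top_pair n p i j k \<and> p k < p j}"

text \<open>If \<open>a < c\<close> were both first positions for \<open>k\<close>, the entry at
  \<open>a\<close> would have to exceed \<open>p k\<close> as an entry left of \<open>c\<close>, yet
  be smaller than \<open>p k\<close> as the start of its own triple. Once \<open>i\<close> is fixed,
  two different middle positions would each have to carry the larger entry.\<close>

lemma top_pair_unique:
  assumes "top_pair n p i j k" "top_pair n p i' j' k"
  shows "i' = i \<and> j' = j"
proof -
  have le: "\<not> a < c" if "top_pair n p a b k" "top_pair n p c d k" for a b c d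
    using that unfolding top_pair_def by (meson less_asym)
  have "i' = i" using le assms by (meson linorder_neqE_nat)
  moreover have "j' = j"
  proof (rule ccontr)
    assume "j' \<noteq> j"
    then have "p j' < p j" "p j < p j'"
      using assms \<open>i' = i\<close> unfolding top_pair_def by auto
    then show False by simp
  qed
  ultimately show ?thesis ..
qed

lemma top_pair_swap:
  assumes "top_pair n p i j k"
  shows "top_pair n (p \<circ> transpose j k) i j k"
  using assms unfolding top_pair_def by (auto simp: transpose_def)

text \<open>Swapping at \<open>j\<close> and \<open>k\<close> may move or change entries of another
  triple. It never changes the first or last position of that triple, or the relative order of its
  last two entries; only the middle position may have to be renamed, hence
  \<open>j''\<close>.\<close>

lemma top_pair_swap_other:
  assumes t: "top_pair n p i j k" and t': "top_pair n p i' j' k'" and ne: "k' \<noteq> k"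
  obtains j'' where "top_pair n (p \<circ> transpose j k) i' j'' k'"
    and "(p \<circ> transpose j k) j'' < (p \<circ> transpose j k) k' \<longleftrightarrow> p j' < p k'"
    and "(p \<circ> transpose j k) k' < (p \<circ> transpose j k) j'' \<longleftrightarrow> p k' < p j'"
proof -
  let ?q = "p \<circ> transpose j k"
  note T = t[unfolded top_pair_def] and T' = t'[unfolded top_pair_def]
  have q: "?q j = p k" "?q k = p j" "\<And>m. m \<noteq> j \<Longrightarrow> m \<noteq> k \<Longrightarrow> ?q m = p m"
    by auto
  \<comment> \<open>The relative position of the two triples is governed by the first positions. If
    \<open>i' < i\<close>, then \<open>p i'\<close> exceeds \<open>p k\<close>, so \<open>k\<close>
    cannot lie to the right of \<open>k'\<close>. If \<open>i < i'\<close>, then \<open>p j'\<close>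
    and \<open>p k'\<close> are below \<open>p i\<close>, so \<open>k'\<close> cannot lie to the
    right of \<open>k\<close>, and the larger entry \<open>p j\<close> cannot lie at a position from
    \<open>i'\<close> to \<open>k'\<close>.\<close>
  have cases: "(i' < j \<and> k < k' \<and> i' \<le> i) \<or> (i' = i \<and> k' \<le> j) \<or> (i' = i \<and> j < k' \<and> k' < k \<and> j' = j)
      \<or> (i < i' \<and> j < i' \<and> k' < k) \<or> (i < i' \<and> k' < j)"
  proof (cases i' i rule: linorder_cases)
    case less
    then have "p j < p i'" "p k < p i'" using T T' by auto
    then have "k \<le> k'" using T T' by (meson not_le less_asym)
    then show ?thesis using less ne T by auto
  next
    case equal
    have "j' = j" if "j < k'" "k' < k"
    proof (rule ccontr)
      assume "j' \<noteq> j"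
      then have "p j' < p j" "p j < p j'" using T T' equal that by auto
      then show False by simp
    qed
    then show ?thesis using equal ne T by linarith
  next
    case greater
    then have small: "p k' < p i" "p j' < p i" using T T' by auto
    have "\<not> k < k'"
    proof
      assume "k < k'"
      then have "p i < p k'" using T T' by blast
      then show False using small(1) by simp
    qed
    then have "k' < k" using ne by simp
    moreover have "\<not> (i' \<le> j \<and> j \<le> k')"
    proof
      assume j: "i' \<le> j \<and> j \<le> k'"
      have "p i < p j" "p i' < p k'" using T T' by blast+
      then have "i' \<noteq> j" "k' \<noteq> j" "j' \<noteq> j" using small by auto
      then have "p j < p j'" using j T' by (metis le_neq_implies_less)
      then show False using small(2) \<open>p i < p j\<close> by simp
    qed
    ultimately show ?thesis using greater by linarith
  qed
  then consider (inside) "i' < j" "k < k'" "i' \<le> i" | (before) "i' = i" "k' \<le> j"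
    | (between) "i' = i" "j < k'" "k' < k" "j' = j"
    | (after) "i < i'" "j < i'" "k' < k" | (later) "i < i'" "k' < j"
    by blast
  then show thesis
  proof cases
    case inside
    \<comment> \<open>Both swapped positions lie strictly between \<open>i'\<close> and
      \<open>k'\<close>, so the swap only permutes the entries there, and the middle position
      follows its entry.\<close>
    have j': "?q (transpose j k j') = p j'" by simp
    have "j < k" using T by blast
    have rng: "i' < transpose j k m \<and> transpose j k m < k'" if "i' < m" "m < k'" for m
      using that \<open>j < k\<close> inside(1,2) by (auto simp: transpose_def)
    have pos: "i' < transpose j k j'" "transpose j k j' < k'" using rng T' by auto
    have mid: "?q m < p j' \<and> ?q m < p k'" if "i' < m" "m < k'" "m \<noteq> transpose j k j'" for m
    proof -
      have "transpose j k m \<noteq> j'" using that(3) by auto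
      then have "p (transpose j k m) < p j' \<and> p (transpose j k m) < p k'"
        using T' rng[OF that(1,2)] by blast
      then show ?thesis by simp
    qed
    have outer: "?q m = p m" if "m \<le> i' \<or> k' \<le> m" for m
      using that \<open>j < k\<close> inside(1,2) by (intro q(3)) auto
    have i': "?q i' = p i'" and k': "?q k' = p k'" by (rule outer, simp)+
    have before: "p j' < ?q m \<and> p k' < ?q m" if "1 \<le> m" "m < i'" for m
    proof -
      have "?q m = p m" using that by (intro outer) simp
      then show ?thesis using that T' by simp
    qed
    have after: "p i' < ?q m" if "k' < m" "m \<le> n" for m
    proof -
      have "?q m = p m" using that by (intro outer) simp
      then show ?thesis using that T' by simp
    qed
    have "top_pair n ?q i' (transpose j k j') k'"
      unfolding top_pair_def j' i' k' using T' pos mid before after by blast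
    then show ?thesis using that[of "transpose j k j'"] j' k' by simp
  next
    case before
    have q': "?q m = p m" if "m < k'" for m using that before T by (intro q(3)) auto
    have after: "p i < ?q m" if "k' < m" "m \<le> n" for m
      using that before T T' by (cases "m = j \<or> m = k") auto
    show ?thesis
    proof (cases "k' = j")
      case True
      \<comment> \<open>Here the last entry of the other triple changes from \<open>p j\<close> to
        \<open>p k\<close>; both exceed every entry strictly between \<open>i\<close> and
        \<open>j\<close>, so the triple stays ascending.\<close>
      have lt: "p m < p k" "p m < p j" if "i < m" "m < j" for m using that T by auto
      have j': "i < j'" "j' < j" using T' before True by auto
      then have "top_pair n ?q i j' j"
        unfolding top_pair_def using T T' True before after lt[of j'] q' lt q(1) by simp
      with j' show ?thesis using that[of j'] lt[of j'] q' q(1) True before by simp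
    next
      case False
      then have "?q k' = p k'" using before T by (intro q(3)) auto
      then have "top_pair n ?q i' j' k'" "?q j' = p j'"
        unfolding top_pair_def using T' before q' after by auto
      then show ?thesis using that[of j'] \<open>?q k' = p k'\<close> by simp
    qed
  next
    case between
    have q': "?q m = p m" if "m < k" "m \<noteq> j" for m using that by (intro q(3)) auto
    have after: "p i < ?q m" if "k' < m" "m \<le> n" for m
      using that between T T' by (cases "m = j \<or> m = k") auto
    \<comment> \<open>The shared middle entry changes from \<open>p j\<close> to \<open>p k\<close>,
      but both exceed \<open>p k'\<close>, so the triple stays descending.\<close>
    have lt: "p k' < p k" "p k' < p j" using between T by auto
    have k': "?q k' = p k'" using q' between by simp
    have mid: "?q m < p k \<and> ?q m < p k'" if "i < m" "m < k'" "m \<noteq> j" for m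
    proof -
      have "p m < p k'" using that T' between by blast
      then show ?thesis using that between q'[of m] lt by simp
    qed
    have pre: "p k < ?q m \<and> p k' < ?q m" if "1 \<le> m" "m < i" for m
    proof -
      have "p k < p m" using that T by blast
      moreover have "?q m = p m" using that T by (intro q') auto
      ultimately show ?thesis using lt by simp
    qed
    have "?q i = p i" using T by (intro q'(1)) auto
    then have "top_pair n ?q i j k'"
      unfolding top_pair_def k' q(1) using T T' between mid pre after by auto
    then show ?thesis using that[of j] between k' q(1) lt by simp
  next
    case after
    \<comment> \<open>The swap exchanges an entry left of \<open>i'\<close> with one right of
      \<open>k'\<close>. Both exceed \<open>p i\<close>, hence all three entries of the other
      triple.\<close>
    have small: "p k' < p i" "p j' < p i" "p i' < p i" using after T T' by auto
    have "?q m = p m" if "i' \<le> m" "m \<le> k'" for m using that after by (intro q(3)) auto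
    moreover have "p j' < ?q m \<and> p k' < ?q m" if "1 \<le> m" "m < i'" for m
      using that small after T T' by (cases "m = j \<or> m = k") auto
    moreover have "p i' < ?q m" if "k' < m" "m \<le> n" for m
      using that small after T T' by (cases "m = j \<or> m = k") auto
    ultimately have "top_pair n ?q i' j' k' \<and> ?q j' = p j' \<and> ?q k' = p k'"
      unfolding top_pair_def using T' by auto
    then show ?thesis using that[of j'] by auto
  next
    case later
    \<comment> \<open>Both swapped positions lie right of \<open>k'\<close>, where entries only have
      to exceed \<open>p i'\<close>.\<close>
    have small: "p i' < p i" using later T T' by auto
    have "?q m = p m" if "m \<le> k'" for m using that later T by (intro q(3)) auto
    moreover have "p i' < ?q m" if "k' < m" "m \<le> n" for m
      using that small later T T' by (cases "m = j \<or> m = k") auto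
    ultimately have "top_pair n ?q i' j' k' \<and> ?q j' = p j' \<and> ?q k' = p k'"
      unfolding top_pair_def using T' by auto
    then show ?thesis using that[of j'] by auto
  qed
qed

section \<open>Toggling at one last position, then at all of them\<close>

definition flip :: "nat \<Rightarrow> nat \<Rightarrow> (nat \<Rightarrow> nat) \<Rightarrow> nat \<Rightarrow> nat" where
  "flip n k p = (if \<exists>i j. top_pair n p i j k then p \<circ> transpose (THE j. \<exists>i. top_pair n p i j k) k else p)"

lemma flip_eq:
  assumes "top_pair n p i j k"
  shows "flip n k p = p \<circ> transpose j k"
proof -
  have "(THE j. \<exists>i. top_pair n p i j k) = j"
    using assms top_pair_unique by (intro the_equality) blast+
  then show ?thesis using assms by (auto simp: flip_def)
qed

lemma flip_eq_self: "\<nexists>i j. top_pair n p i j k \<Longrightarrow> flip n k p = p"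
  by (auto simp: flip_def)

lemma flip_flip: "flip n k (flip n k p) = p"
proof (cases "\<exists>i j. top_pair n p i j k")
  case True
  then obtain i j where t: "top_pair n p i j k" by blast
  have "flip n k (flip n k p) = p \<circ> transpose j k \<circ> transpose j k"
    using flip_eq[OF t] flip_eq[OF top_pair_swap[OF t]] by simp
  then show ?thesis by (simp add: comp_assoc)
qed (simp add: flip_eq_self)

lemma flip_permutes:
  assumes "p permutes {1..n}"
  shows "flip n k p permutes {1..n}"
proof (cases "\<exists>i j. top_pair n p i j k")
  case True
  then obtain i j where t: "top_pair n p i j k" by blast
  then have "transpose j k permutes {1..n}"
    by (intro permutes_swap_id) (auto simp: top_pair_def)
  then show ?thesis using assms by (simp add: flip_eq[OF t] permutes_compose)
next
  case False
  then have "flip n k p = p" by (rule flip_eq_self)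
  then show ?thesis using assms by simp
qed

text \<open>At \<open>k\<close> itself the swap reverses the order of the last two entries; at every
  other position \<open>top_pair_swap_other\<close> preserves the kind of triple.\<close>

lemma ends_flip_le:
  "k' \<in> asc_ends n p \<Longrightarrow> k' \<in> (if k' = k then desc_ends else asc_ends) n (flip n k p)"
  "k' \<in> desc_ends n p \<Longrightarrow> k' \<in> (if k' = k then asc_ends else desc_ends) n (flip n k p)"
proof -
  have "(k' \<in> asc_ends n p \<longrightarrow> k' \<in> (if k' = k then desc_ends else asc_ends) n (flip n k p)) \<and>
    (k' \<in> desc_ends n p \<longrightarrow> k' \<in> (if k' = k then asc_ends else desc_ends) n (flip n k p))"
  proof (cases "\<exists>i j. top_pair n p i j k")
    case False
    then show ?thesis by (auto simp: flip_eq_self asc_ends_def desc_ends_def)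
  next
    case True
    then obtain i j where t: "top_pair n p i j k" by blast
    show ?thesis
    proof (cases "k' = k")
      case True
      have "j'' = j" if "top_pair n p i'' j'' k" for i'' j''
        using top_pair_unique[OF t that] by simp
      then have "k \<in> asc_ends n p \<longrightarrow> p j < p k" "k \<in> desc_ends n p \<longrightarrow> p k < p j"
        unfolding asc_ends_def desc_ends_def by blast+
      moreover have "p k < p j \<longrightarrow> k \<in> asc_ends n (flip n k p)" "p j < p k \<longrightarrow> k \<in> desc_ends n (flip n k p)"
        using top_pair_swap[OF t] unfolding flip_eq[OF t] asc_ends_def desc_ends_def by force+
      ultimately show ?thesis using True by simp
    next
      case False
      then show ?thesis
        unfolding flip_eq[OF t] asc_ends_def desc_ends_def
        using top_pair_swap_other[OF t _ False] by (simp; metis)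
    qed
  qed
  then show "k' \<in> asc_ends n p \<Longrightarrow> k' \<in> (if k' = k then desc_ends else asc_ends) n (flip n k p)"
    "k' \<in> desc_ends n p \<Longrightarrow> k' \<in> (if k' = k then asc_ends else desc_ends) n (flip n k p)"
    by blast+
qed

text \<open>The converse inclusions are \<open>ends_flip_le\<close> applied to the flipped
  permutation, because \<open>flip n k\<close> is an involution.\<close>

lemma ends_flip:
  "k' \<in> asc_ends n (flip n k p) \<longleftrightarrow> k' \<in> (if k' = k then desc_ends else asc_ends) n p"
  "k' \<in> desc_ends n (flip n k p) \<longleftrightarrow> k' \<in> (if k' = k then asc_ends else desc_ends) n p"
  using ends_flip_le[of k' n p k] ends_flip_le[of k' n "flip n k p" k]
  by (auto simp: flip_flip split: if_splits)

text \<open>Each flip exchanges membership in the two sets at its own position only, so composing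
  flips over the elements of \<open>K\<close> in any order exchanges it exactly on
  \<open>K\<close>.\<close>

lemma swap_ends_on:
  assumes "finite K"
  shows "\<exists>F. bij_betw F {p. p permutes {1..n}} {p. p permutes {1..n}} \<and>
    (\<forall>p k. (k \<in> asc_ends n (F p) \<longleftrightarrow> k \<in> (if k \<in> K then desc_ends else asc_ends) n p) \<and>
           (k \<in> desc_ends n (F p) \<longleftrightarrow> k \<in> (if k \<in> K then asc_ends else desc_ends) n p))"
  using assms
proof (induction K)
  case empty
  show ?case by (rule exI[of _ id]) (simp only: bij_betw_id, simp)
next
  case (insert x K)
  then obtain F where F: "bij_betw F {p. p permutes {1..n}} {p. p permutes {1..n}}"
    "\<And>p k. k \<in> asc_ends n (F p) \<longleftrightarrow> k \<in> (if k \<in> K then desc_ends else asc_ends) n p"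
    "\<And>p k. k \<in> desc_ends n (F p) \<longleftrightarrow> k \<in> (if k \<in> K then asc_ends else desc_ends) n p"
    by blast
  have "bij_betw (flip n x) {p. p permutes {1..n}} {p. p permutes {1..n}}"
    by (rule bij_betw_byWitness[where f' = "flip n x"]) (use flip_flip flip_permutes in blast)+
  with F(1) have "bij_betw (flip n x \<circ> F) {p. p permutes {1..n}} {p. p permutes {1..n}}"
    by (rule bij_betw_trans)
  moreover have "\<forall>p k. (k \<in> asc_ends n ((flip n x \<circ> F) p) \<longleftrightarrow>
        k \<in> (if k \<in> insert x K then desc_ends else asc_ends) n p) \<and>
      (k \<in> desc_ends n ((flip n x \<circ> F) p) \<longleftrightarrow>
        k \<in> (if k \<in> insert x K then asc_ends else desc_ends) n p)"
    using insert.hyps(2) by (simp add: ends_flip F(2,3))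
  ultimately show ?case by blast
qed

lemma swap_ends:
  obtains F where "bij_betw F {p. p permutes {1..n}} {p. p permutes {1..n}}"
    and "\<And>p. asc_ends n (F p) = desc_ends n p" and "\<And>p. desc_ends n (F p) = asc_ends n p"
proof -
  \<comment> \<open>Exchanging on \<open>{1..n}\<close> exchanges the whole sets, as neither has
    elements elsewhere.\<close>
  have sub: "asc_ends n p \<subseteq> {1..n}" "desc_ends n p \<subseteq> {1..n}" for p
    by (auto simp: asc_ends_def desc_ends_def top_pair_def)
  obtain F where F: "bij_betw F {p. p permutes {1..n}} {p. p permutes {1..n}}"
    "\<And>p k. k \<in> asc_ends n (F p) \<longleftrightarrow> k \<in> (if k \<in> {1..n} then desc_ends else asc_ends) n p"
    "\<And>p k. k \<in> desc_ends n (F p) \<longleftrightarrow> k \<in> (if k \<in> {1..n} then asc_ends else desc_ends) n p"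
    using swap_ends_on[of "{1..n}" n] by blast
  show thesis
  proof (rule that[OF F(1)])
    show "asc_ends n (F p) = desc_ends n p" for p
      using sub[of p] sub[of "F p"] F(2)[of _ p] by (auto split: if_splits)
    show "desc_ends n (F p) = asc_ends n p" for p
      using sub[of p] sub[of "F p"] F(3)[of _ p] by (auto split: if_splits)
  qed
qed

section \<open>From sets of last positions to joint distributions\<close>

lemma card_bij_betw_Collect:
  assumes "bij_betw f A B"
  shows "card {x \<in> A. P (f x)} = card {y \<in> B. P y}"
proof -
  have "f ` {x \<in> A. P (f x)} = {y \<in> f ` A. P y}" by auto
  moreover have "f ` A = B" "inj_on f {x \<in> A. P (f x)}"
    using assms by (auto simp: bij_betw_def intro: inj_on_subset)
  ultimately show ?thesis by (metis card_image)
qed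

text \<open>The bijection \<open>G\<close> lets one argument serve both shadings: the identity for
  the first, inversion for its transpose.\<close>

lemma jointly_equidistributed_if_ends:
  assumes G: "\<And>n. bij_betw (G n) {p. p permutes {1..n}} {p. p permutes {1..n}}"
    and q1: "\<And>n p. p permutes {1..n} \<Longrightarrow> occurrences q1 (word n p) = card (asc_ends n (G n p))"
    and q2: "\<And>n p. p permutes {1..n} \<Longrightarrow> occurrences q2 (word n p) = card (desc_ends n (G n p))"
  shows "q1 \<sim>\<^sub>j\<^sub>d q2"
  unfolding jointly_equidistributed_def
proof (intro allI)
  fix n k l :: nat
  let ?P = "{p. p permutes {1..n}}"
  let ?Q = "\<lambda>a b. {p \<in> ?P. card (asc_ends n p) = a \<and> card (desc_ends n p) = b}"
  have Q: "card {\<pi> \<in> perms n. occurrences q1 \<pi> = a \<and> occurrences q2 \<pi> = b} = card (?Q a b)" for a b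
  proof -
    have "card {\<pi> \<in> perms n. occurrences q1 \<pi> = a \<and> occurrences q2 \<pi> = b} =
        card {p \<in> ?P. occurrences q1 (word n p) = a \<and> occurrences q2 (word n p) = b}"
      by (rule card_bij_betw_Collect[OF bij_betw_word, symmetric])
    also have "{p \<in> ?P. occurrences q1 (word n p) = a \<and> occurrences q2 (word n p) = b} =
        {p \<in> ?P. card (asc_ends n (G n p)) = a \<and> card (desc_ends n (G n p)) = b}"
      by (rule Collect_cong) (simp only: mem_Collect_eq q1 q2 cong: conj_cong)
    also have "card \<dots> = card (?Q a b)"
      by (rule card_bij_betw_Collect[OF G])
    finally show ?thesis .
  qed
  obtain F where F: "bij_betw F ?P ?P" "\<And>p. asc_ends n (F p) = desc_ends n p"
      "\<And>p. desc_ends n (F p) = asc_ends n p"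
    by (rule swap_ends) blast
  have "card {p \<in> ?P. card (asc_ends n (F p)) = k \<and> card (desc_ends n (F p)) = l} = card (?Q k l)"
    by (rule card_bij_betw_Collect[OF F(1)])
  then have "card (?Q k l) = card (?Q l k)"
    unfolding F(2,3) by (simp only: conj_commute)
  then show "card {\<pi> \<in> perms n. occurrences q1 \<pi> = k \<and> occurrences q2 \<pi> = l} =
      card {\<pi> \<in> perms n. occurrences q1 \<pi> = l \<and> occurrences q2 \<pi> = k}"
    unfolding Q .
qed

section \<open>Shaded boxes\<close>

lemma order_isomorphic_3:
  "order_isomorphic [x, y, z] [1, 2, 3] \<longleftrightarrow> x < y \<and> y < z"
  "order_isomorphic [x, y, z] [1, 3, 2] \<longleftrightarrow> x < z \<and> z < y"
  by (auto simp: order_isomorphic_def All_less_Suc numeral_3_eq_3)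

lemma occurrence_length: "occurrence (\<tau>, R) \<pi> is \<Longrightarrow> length is = length \<tau>"
  by (auto simp: occurrence_def order_isomorphic_def Let_def)

lemma mesh_box:
  "\<not> (\<exists>m\<in>{1..n}. a < m \<and> m < b \<and> c < entry (word n p) m \<and> entry (word n p) m < d) \<longleftrightarrow>
   (\<forall>m. 1 \<le> m \<and> m \<le> n \<longrightarrow> a < m \<longrightarrow> m < b \<longrightarrow> c < p m \<longrightarrow> \<not> p m < d)"
  unfolding bex_simps ball_simps by (auto simp: entry_word)

text \<open>Both patterns have their smallest entry first. With \<open>x\<close> and
  \<open>y\<close> the positions of the middle and largest entries, the sorted values are
  \<open>p i\<close>, \<open>p x\<close>, \<open>p y\<close> in either case, which treats 123 and
  132 uniformly.\<close>

lemma occurrence_3: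
  assumes \<tau>: "\<tau> = [1, 2, 3] \<and> x = j \<and> y = k \<or> \<tau> = [1, 3, 2] \<and> x = k \<and> y = j"
  shows "occurrence (\<tau>, S) (word n p) [i, j, k] \<longleftrightarrow>
    (1 \<le> i \<and> i < j \<and> j < k \<and> k \<le> n \<and> p i < p x \<and> p x < p y) \<and>
    (\<forall>(a, b) \<in> S. \<forall>m. 1 \<le> m \<and> m \<le> n \<longrightarrow> [0, i, j, k, n + 1] ! a < m \<longrightarrow> m < [0, i, j, k, n + 1] ! (a + 1) \<longrightarrow>
       [0, p i, p x, p y, n + 1] ! b < p m \<longrightarrow> \<not> p m < [0, p i, p x, p y, n + 1] ! (b + 1))"
proof (cases "1 \<le> i \<and> i < j \<and> j < k \<and> k \<le> n \<and> p i < p x \<and> p x < p y")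
  case True
  then have e: "entry (word n p) i = p i" "entry (word n p) j = p j" "entry (word n p) k = p k"
    by (auto intro!: entry_word)
  have "sort [p i, p j, p k] = [p i, p x, p y]" using True \<tau> by auto
  moreover have "order_isomorphic [p i, p j, p k] \<tau>"
    using True \<tau> by (auto simp: order_isomorphic_3[simplified])
  moreover have "sorted_wrt (<) [i, j, k]" "set [i, j, k] \<subseteq> {1..n}" using True by auto
  ultimately have "occurrence (\<tau>, S) (word n p) [i, j, k] \<longleftrightarrow>
    (\<forall>(a, b) \<in> S. \<forall>m. 1 \<le> m \<and> m \<le> n \<longrightarrow> [0, i, j, k, n + 1] ! a < m \<longrightarrow> m < [0, i, j, k, n + 1] ! (a + 1) \<longrightarrow>
       [0, p i, p x, p y, n + 1] ! b < p m \<longrightarrow> \<not> p m < [0, p i, p x, p y, n + 1] ! (b + 1))"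
    unfolding occurrence_def Let_def prod.case list.map e length_word append_Cons append_Nil mesh_box
    by (simp only: append_Cons append_Nil simp_thms)
  then show ?thesis using True by (simp only: simp_thms)
next
  case False
  have "\<not> occurrence (\<tau>, S) (word n p) [i, j, k]"
  proof
    assume o: "occurrence (\<tau>, S) (word n p) [i, j, k]"
    then have "sorted_wrt (<) [i, j, k] \<and> set [i, j, k] \<subseteq> {1..n} \<and>
        order_isomorphic (map (entry (word n p)) [i, j, k]) \<tau>"
      unfolding occurrence_def Let_def prod.case length_word by (elim conjE) (intro conjI)
    then have ijk: "1 \<le> i" "i < j" "j < k" "k \<le> n"
      and iso: "order_isomorphic [entry (word n p) i, entry (word n p) j, entry (word n p) k] \<tau>"
      by auto
    have "entry (word n p) i = p i" "entry (word n p) j = p j" "entry (word n p) k = p k"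
      using ijk by (auto intro!: entry_word)
    then have "p i < p x \<and> p x < p y"
      using iso \<tau> order_isomorphic_3 by metis
    with ijk have "1 \<le> i \<and> i < j \<and> j < k \<and> k \<le> n \<and> p i < p x \<and> p x < p y"
      by (intro conjI) simp_all
    with False show False by (rule notE)
  qed
  then show ?thesis using False by (simp only: simp_thms)
qed

text \<open>Inversion reflects the plot of \<open>p\<close> in the diagonal: the values in
  increasing order become the positions, and box \<open>(a, b)\<close> becomes
  \<open>(b, a)\<close>. The pattern survives because it is an involution.\<close>

lemma occurrence_converse:
  assumes p: "p permutes {1..n}"
    and \<tau>: "\<tau> = [1, 2, 3] \<and> x = j \<and> y = k \<or> \<tau> = [1, 3, 2] \<and> x = k \<and> y = j"
  shows "occurrence (\<tau>, S\<inverse>) (word n p) [i, j, k] \<longleftrightarrow>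
    occurrence (\<tau>, S) (word n (inv p)) [p i, p x, p y]"
proof -
  have inv: "inv p (p m) = m" for m using p by (simp add: permutes_inverses)
  have rng: "1 \<le> p m \<and> p m \<le> n \<longleftrightarrow> 1 \<le> m \<and> m \<le> n" for m
    using permutes_in_image[OF p, of m] by simp
  let ?pos = "[0, i, j, k, n + 1]" and ?val = "[0, p i, p x, p y, n + 1]"
  let ?free = "\<lambda>a b m. 1 \<le> m \<and> m \<le> n \<longrightarrow> ?pos ! a < m \<longrightarrow> m < ?pos ! (a + 1) \<longrightarrow>
       ?val ! b < p m \<longrightarrow> \<not> p m < ?val ! (b + 1)"
  let ?free' = "\<lambda>a b m. 1 \<le> m \<and> m \<le> n \<longrightarrow> ?val ! a < m \<longrightarrow> m < ?val ! (a + 1) \<longrightarrow>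
       ?pos ! b < inv p m \<longrightarrow> \<not> inv p m < ?pos ! (b + 1)"
  \<comment> \<open>A point with position \<open>m\<close> and value \<open>p m\<close> has position
    \<open>p m\<close> and value \<open>m\<close> in the inverse.\<close>
  have box: "?free' a b (p m) \<longleftrightarrow> ?free b a m" for a b m
    unfolding inv rng by blast
  have perm_all: "(\<forall>m. Q (p m)) \<longleftrightarrow> (\<forall>m. Q m)" for Q
    by (metis p permutes_inverses(1))
  have "(\<forall>m. ?free' a b m) \<longleftrightarrow> (\<forall>m. ?free b a m)" for a b
    using perm_all[of "?free' a b"] unfolding box by (rule sym)
  then have boxes: "(\<forall>(a, b) \<in> S. \<forall>m. ?free' a b m) \<longleftrightarrow> (\<forall>(a, b) \<in> S\<inverse>. \<forall>m. ?free a b m)"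
    by blast
  \<comment> \<open>Each side bounds only its outermost positions or values; the other bounds follow
    because \<open>p\<close> preserves \<open>{1..n}\<close>.\<close>
  have triple: "1 \<le> p i \<and> p i < p x \<and> p x < p y \<and> p y \<le> n \<and> i < j \<and> j < k \<longleftrightarrow>
     1 \<le> i \<and> i < j \<and> j < k \<and> k \<le> n \<and> p i < p x \<and> p x < p y"
  proof -
    have "x = j \<and> y = k \<or> x = k \<and> y = j" using \<tau> by blast
    then have k: "p k = p x \<or> p k = p y" and y: "y = j \<or> y = k" by blast+
    show ?thesis
    proof
      assume L: "1 \<le> p i \<and> p i < p x \<and> p x < p y \<and> p y \<le> n \<and> i < j \<and> j < k"
      then have "1 \<le> p i \<and> p i \<le> n" "1 \<le> p k \<and> p k \<le> n" using k by linarith+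
      then show "1 \<le> i \<and> i < j \<and> j < k \<and> k \<le> n \<and> p i < p x \<and> p x < p y"
        using L unfolding rng by blast
    next
      assume R: "1 \<le> i \<and> i < j \<and> j < k \<and> k \<le> n \<and> p i < p x \<and> p x < p y"
      then have "1 \<le> i \<and> i \<le> n" "1 \<le> y \<and> y \<le> n" using y by linarith+
      then have "1 \<le> p i \<and> p i \<le> n" "1 \<le> p y \<and> p y \<le> n" by (simp_all only: rng)
      then show "1 \<le> p i \<and> p i < p x \<and> p x < p y \<and> p y \<le> n \<and> i < j \<and> j < k"
        using R by blast
    qed
  qed
  \<comment> \<open>In the inverse the values are \<open>i < j < k\<close>, so \<open>p j\<close>
    and \<open>p k\<close> are the positions of the middle and largest ones.\<close>
  have "\<tau> = [1, 2, 3] \<and> p j = p x \<and> p k = p y \<or> \<tau> = [1, 3, 2] \<and> p j = p y \<and> p k = p x"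
    using \<tau> by auto
  from occurrence_3[OF this, of S n "inv p" "p i"]
  have "occurrence (\<tau>, S) (word n (inv p)) [p i, p x, p y] \<longleftrightarrow>
    (1 \<le> p i \<and> p i < p x \<and> p x < p y \<and> p y \<le> n \<and> i < j \<and> j < k) \<and>
    (\<forall>(a, b) \<in> S. \<forall>m. ?free' a b m)"
    by (simp only: inv)
  also have "\<dots> \<longleftrightarrow> occurrence (\<tau>, S\<inverse>) (word n p) [i, j, k]"
    unfolding boxes triple occurrence_3[OF \<tau>] ..
  finally show ?thesis ..
qed

lemma occurrences_converse:
  assumes p: "p permutes {1..n}" and \<tau>: "\<tau> = [1, 2, 3] \<or> \<tau> = [1, 3, 2]"
  shows "occurrences (\<tau>, S\<inverse>) (word n p) = occurrences (\<tau>, S) (word n (inv p))"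
proof -
  \<comment> \<open>The indices \<open>a\<close> and \<open>b\<close> locate the middle and largest
    entries of the pattern, so \<open>f p\<close> lists the values of an occurrence in increasing
    order. Since exchanging the last two places is an involution, \<open>f (inv p)\<close> undoes
    it.\<close>
  define a b :: nat where "a = (if \<tau> = [1, 2, 3] then 1 else 2)" and "b = (if \<tau> = [1, 2, 3] then 2 else 1)"
  define f :: "(nat \<Rightarrow> nat) \<Rightarrow> nat list \<Rightarrow> nat list" where "f r is = [r (is ! 0), r (is ! a), r (is ! b)]" for r "is"
  have ab: "a = 1 \<and> b = 2 \<or> a = 2 \<and> b = 1" by (auto simp: a_def b_def)
  have iff: "occurrence (\<tau>, S\<inverse>) (word n r) is \<longleftrightarrow> occurrence (\<tau>, S) (word n (inv r)) (f r is)"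
    if r: "r permutes {1..n}" and len: "length is = 3" for r "is" S
  proof -
    obtain i j k where is_eq: "is = [i, j, k]" using len by (auto simp: numeral_3_eq_3 length_Suc_conv)
    have "\<tau> = [1, 2, 3] \<and> is ! a = j \<and> is ! b = k \<or> \<tau> = [1, 3, 2] \<and> is ! a = k \<and> is ! b = j"
      using \<tau> by (elim disjE) (simp_all add: a_def b_def is_eq)
    from occurrence_converse[OF r this, of S i]
    have "occurrence (\<tau>, S\<inverse>) (word n r) [i, j, k] \<longleftrightarrow>
      occurrence (\<tau>, S) (word n (inv r)) [r i, r (is ! a), r (is ! b)]" .
    moreover have "f r is = [r i, r (is ! a), r (is ! b)]" by (simp add: f_def is_eq)
    ultimately show ?thesis by (simp only: is_eq)
  qed
  have ff: "f (inv p) (f p is) = is" "f p (f (inv p) is) = is" if "length is = 3" for "is"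
    using that ab permutes_inverses[OF p] by (auto simp: f_def numeral_3_eq_3 length_Suc_conv)
  have len: "occurrence (\<tau>, T) \<pi> is \<Longrightarrow> length is = 3" for T \<pi> "is"
    using \<tau> occurrence_length by fastforce
  have "bij_betw (f p) {is. occurrence (\<tau>, S\<inverse>) (word n p) is} {is. occurrence (\<tau>, S) (word n (inv p)) is}"
  proof (rule bij_betw_byWitness[where f' = "f (inv p)"])
    show "f p ` {is. occurrence (\<tau>, S\<inverse>) (word n p) is} \<subseteq> {is. occurrence (\<tau>, S) (word n (inv p)) is}"
      using iff[OF p] len by blast
    show "f (inv p) ` {is. occurrence (\<tau>, S) (word n (inv p)) is} \<subseteq> {is. occurrence (\<tau>, S\<inverse>) (word n p) is}"
    proof clarify
      fix "is" assume o: "occurrence (\<tau>, S) (word n (inv p)) is"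
      have "length (f (inv p) is) = 3" by (simp add: f_def)
      then show "occurrence (\<tau>, S\<inverse>) (word n p) (f (inv p) is)"
        using iff[OF p] ff(2)[OF len[OF o]] o by simp
    qed
  qed (use ff len in blast)+
  then show ?thesis unfolding occurrences_def by (rule bij_betw_same_card)
qed

text \<open>Read the shading by columns. Column 0 puts all entries left of \<open>i\<close> above
  the largest value, columns 1 and 2 put the remaining entries between \<open>i\<close> and
  \<open>k\<close> below the middle value, and box \<open>(3,0)\<close> puts all entries right of
  \<open>k\<close> above \<open>p i\<close>.\<close>

lemma occurrence_top_pair:
  assumes p: "p permutes {1..n}"
    and R: "R = {(0,0), (0,1), (0,2), (3,0), (1,2), (1,3), (2,2), (2,3)}"
  shows "occurrence ([1, 2, 3], R) (word n p) [i, j, k] \<longleftrightarrow> top_pair n p i j k \<and> p j < p k"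
    and "occurrence ([1, 3, 2], R) (word n p) [i, j, k] \<longleftrightarrow> top_pair n p i j k \<and> p k < p j"
proof -
  have ne: "p m \<noteq> p m'" if "m \<noteq> m'" for m m'
    using that permutes_inj[OF p] by (auto dest: injD)
  have rng: "0 < p m \<and> p m < Suc n" if "1 \<le> m" "m \<le> n" for m
    using permutes_in_image[OF p, of m] that by auto
  have main: "((1 \<le> i \<and> i < j \<and> j < k \<and> k \<le> n \<and> p i < p x \<and> p x < p y) \<and>
    (\<forall>(a, b) \<in> R. \<forall>m. 1 \<le> m \<and> m \<le> n \<longrightarrow> [0, i, j, k, n + 1] ! a < m \<longrightarrow> m < [0, i, j, k, n + 1] ! (a + 1) \<longrightarrow>
       [0, p i, p x, p y, n + 1] ! b < p m \<longrightarrow> \<not> p m < [0, p i, p x, p y, n + 1] ! (b + 1)))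
    \<longleftrightarrow> top_pair n p i j k \<and> p x < p y" (is "?L \<longleftrightarrow> ?T")
    if xy: "x = j \<and> y = k \<or> x = k \<and> y = j" for x y
  proof
    assume L: ?L
    then have o: "1 \<le> i" "i < j" "j < k" "k \<le> n" "p i < p x" "p x < p y" by auto
    have free: "\<not> p m < [0, p i, p x, p y, n + 1] ! (b + 1)"
      if "(a, b) \<in> R" "1 \<le> m" "m \<le> n" "[0, i, j, k, n + 1] ! a < m" "m < [0, i, j, k, n + 1] ! (a + 1)"
        "[0, p i, p x, p y, n + 1] ! b < p m" for a b m
      using L that by blast
    have "p y < p m" if "1 \<le> m" "m < i" for m
    proof -
      \<comment> \<open>Boxes are open, so the boundary values have to be excluded separately, by
        injectivity.\<close>
      have "\<not> p m < p i" "\<not> (p i < p m \<and> p m < p x)" "\<not> (p x < p m \<and> p m < p y)"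
        using free[of 0 0 m] free[of 0 1 m] free[of 0 2 m] rng[of m] that o unfolding R by auto
      moreover have "p m \<noteq> p i" "p m \<noteq> p x" "p m \<noteq> p y"
        using xy that o by (auto intro!: ne)
      ultimately show ?thesis by linarith
    qed
    moreover have "p m < p x" if "i < m" "m < k" "m \<noteq> j" for m
    proof -
      have "\<not> (p x < p m \<and> p m < p y)" "\<not> p y < p m"
        using free[of 1 2 m] free[of 1 3 m] free[of 2 2 m] free[of 2 3 m] rng[of m] that o
        unfolding R by (cases "m < j"; auto)+
      moreover have "p m \<noteq> p x" "p m \<noteq> p y"
        using xy that o by (auto intro!: ne)
      ultimately show ?thesis by linarith
    qed
    moreover have "p i < p m" if "k < m" "m \<le> n" for m
    proof -
      have "\<not> p m < p i" using free[of 3 0 m] rng[of m] that o unfolding R by auto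
      moreover have "p m \<noteq> p i" using that o by (auto intro!: ne)
      ultimately show ?thesis by linarith
    qed
    \<comment> \<open>As \<open>p x\<close> and \<open>p y\<close> are the minimum and maximum of
      \<open>p j\<close> and \<open>p k\<close>, the bounds become the symmetric ones of
      \<open>top_pair\<close>.\<close>
    moreover have "p j < v \<and> p k < v" if "p y < v" for v using that o(6) xy by (elim disjE) auto
    moreover have "v < p j \<and> v < p k" if "v < p x" for v using that o(6) xy by (elim disjE) auto
    moreover have "p i < p j" "p i < p k" using o(5,6) xy by (elim disjE; simp)+
    ultimately show ?T using o unfolding top_pair_def by blast
  next
    assume T: ?T
    have before: "p y < p m" if "1 \<le> m" "m < i" for m
      using that xy T unfolding top_pair_def by blast
    have between: "p m < p x" if "i < m" "m < k" "m \<noteq> j" for m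
      using that xy T unfolding top_pair_def by blast
    have after: "p i < p m" if "k < m" "m \<le> n" for m
      using that T unfolding top_pair_def by blast
    have o: "1 \<le> i" "i < j" "j < k" "k \<le> n" "p i < p x" "p x < p y"
      using T xy unfolding top_pair_def by auto
    have "\<not> p m < [0, p i, p x, p y, n + 1] ! (b + 1)"
      if R': "(a, b) \<in> R" and m: "1 \<le> m" "m \<le> n" "[0, i, j, k, n + 1] ! a < m" "m < [0, i, j, k, n + 1] ! (a + 1)"
        "[0, p i, p x, p y, n + 1] ! b < p m" for a b m
    proof -
      have "a = 0 \<and> b \<le> 2 \<or> a = 3 \<and> b = 0 \<or> (a = 1 \<or> a = 2) \<and> (b = 2 \<or> b = 3)"
        using R' unfolding R by auto
      then consider "a = 0" "b = 0 \<or> b = 1 \<or> b = 2" | "a = 3" "b = 0" | "a = 1 \<or> a = 2" "b = 2 \<or> b = 3"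
        by linarith
      then show ?thesis
      proof cases
        case 1
        then show ?thesis using before[of m] m o by auto
      next
        case 2
        then show ?thesis using after[of m] m by auto
      next
        case 3
        then have "i < m" "m < k" "m \<noteq> j" using m o by auto
        then show ?thesis using between[of m] 3 m o by auto
      qed
    qed
    then show ?L using o by blast
  qed
  show "occurrence ([1, 2, 3], R) (word n p) [i, j, k] \<longleftrightarrow> top_pair n p i j k \<and> p j < p k"
    by (subst occurrence_3[where x = j and y = k]) (simp, rule main, simp)
  show "occurrence ([1, 3, 2], R) (word n p) [i, j, k] \<longleftrightarrow> top_pair n p i j k \<and> p k < p j"
    by (subst occurrence_3[where x = k and y = j]) (simp, rule main, simp)
qed

text \<open>By \<open>top_pair_unique\<close> an occurrence is determined by its last position, so
  \<open>last\<close> is a bijection from occurrences to end positions.\<close>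

lemma occurrences_ends:
  assumes p: "p permutes {1..n}"
    and R: "R = {(0,0), (0,1), (0,2), (3,0), (1,2), (1,3), (2,2), (2,3)}"
  shows "occurrences ([1, 2, 3], R) (word n p) = card (asc_ends n p)"
    and "occurrences ([1, 3, 2], R) (word n p) = card (desc_ends n p)"
proof -
  have count: "card {is. occurrence (\<tau>, R) (word n p) is} = card {k. \<exists>i j. top_pair n p i j k \<and> P j k}"
    if \<tau>: "length \<tau> = 3"
      and iff: "\<And>i j k. occurrence (\<tau>, R) (word n p) [i, j, k] \<longleftrightarrow> top_pair n p i j k \<and> P j k" for \<tau> P
  proof -
    have shape: "\<exists>i j k. is = [i, j, k] \<and> top_pair n p i j k \<and> P j k"
      if occ: "occurrence (\<tau>, R) (word n p) is" for "is"
    proof -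
      obtain i j k where "is = [i, j, k]"
        using occurrence_length[OF occ] \<tau> by (auto simp: numeral_3_eq_3 length_Suc_conv)
      then show ?thesis using occ iff by blast
    qed
    have "bij_betw last {is. occurrence (\<tau>, R) (word n p) is} {k. \<exists>i j. top_pair n p i j k \<and> P j k}"
      unfolding bij_betw_def
    proof
      show "inj_on last {is. occurrence (\<tau>, R) (word n p) is}"
      proof (rule inj_onI, unfold mem_Collect_eq)
        fix xs ys
        assume "occurrence (\<tau>, R) (word n p) xs" "occurrence (\<tau>, R) (word n p) ys" and eq: "last xs = last ys"
        then obtain i j k i' j' k' where "xs = [i, j, k]" "top_pair n p i j k"
          "ys = [i', j', k']" "top_pair n p i' j' k'"
          using shape by metis
        then show "xs = ys" using eq top_pair_unique by simp
      qed
      show "last ` {is. occurrence (\<tau>, R) (word n p) is} = {k. \<exists>i j. top_pair n p i j k \<and> P j k}"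
      proof safe
        fix "is" assume "occurrence (\<tau>, R) (word n p) is"
        then obtain i j k where "is = [i, j, k]" "top_pair n p i j k \<and> P j k" using shape by blast
        then show "\<exists>i j. top_pair n p i j (last is) \<and> P j (last is)" by auto
      next
        fix k i j assume "top_pair n p i j k" "P j k"
        then have "occurrence (\<tau>, R) (word n p) [i, j, k]" by (simp add: iff)
        then show "k \<in> last ` {is. occurrence (\<tau>, R) (word n p) is}" by force
      qed
    qed
    then show ?thesis by (rule bij_betw_same_card)
  qed
  show "occurrences ([1, 2, 3], R) (word n p) = card (asc_ends n p)"
    unfolding occurrences_def asc_ends_def
    by (rule count) (simp, rule occurrence_top_pair(1)[OF p R])
  show "occurrences ([1, 3, 2], R) (word n p) = card (desc_ends n p)"
    unfolding occurrences_def desc_ends_def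
    by (rule count) (simp, rule occurrence_top_pair(2)[OF p R])
qed

theorem theorem3p6:
  fixes R R' :: "(nat \<times> nat) set"
  assumes "R = {(0,0), (0,1), (0,2), (3,0), (1,2), (1,3), (2,2), (2,3)}"
    and "R' = {(0,0), (1,0), (2,0), (0,3), (2,1), (2,2), (3,1), (3,2)}"
  shows "([1,2,3], R) \<sim>\<^sub>j\<^sub>d ([1,3,2], R) \<and> ([1,2,3], R') \<sim>\<^sub>j\<^sub>d ([1,3,2], R')"
proof
  show "([1,2,3], R) \<sim>\<^sub>j\<^sub>d ([1,3,2], R)"
    by (rule jointly_equidistributed_if_ends[where G = "\<lambda>n p. p"])
      (simp_all only: bij_betw_id[unfolded id_def] occurrences_ends[OF _ assms(1)])
  have R': "R' = R\<inverse>" unfolding assms by auto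
  have inv: "bij_betw inv {p. p permutes {1..n}} {p. p permutes {1..n}}" for n :: nat
    by (rule bij_betw_byWitness[where f' = inv]) (auto simp: permutes_inv_inv intro: permutes_inv)
  \<comment> \<open>With inversion as \<open>G\<close>, \<open>occurrences_converse\<close> turns
    counts for the transposed shading at \<open>p\<close> into counts for \<open>R\<close> at
    \<open>inv p\<close>.\<close>
  show "([1,2,3], R') \<sim>\<^sub>j\<^sub>d ([1,3,2], R')"
    unfolding R'
    by (rule jointly_equidistributed_if_ends[where G = "\<lambda>n. inv"])
      (simp_all only: inv occurrences_converse permutes_inv occurrences_ends[OF _ assms(1)] simp_thms)
qed

end
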